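(* Let $R\subset S$ be an extension of commutative rings with unity and let $G$ be a subgroup of $\mathrm{Aut}(S)$ such that $\sigma(R)\subseteq R$ for all $\sigma\in G$. If $R$ is root-closed in $S$, then $R^G$ is root-closed in $S^G$.
   Context: $\mathrm{Aut}(S)$ is the group of ring automorphisms of $S$. $S^G=\{s\in S : \sigma(s)=s \text{ for all } \sigma\in G\}$ and $R^G=\{r\in R : \sigma(r)=r \text{ for all } \sigma\in G\}=R\cap S^G$. For a ring extension $R\subset S$, $R$ is said to be root-closed in $S$ if, for every $x\in S$ and every integer $n\geq 1$, $x^n\in R$ implies $x\in R$. *)

theory Defs
  imports "HOL-Algebra.Algebra"
begin

text \<open>As for \<^const>\<open>auto\<close> and \<^const>\<open>AutoGroup\<close>, automorphisms are taken to be extensional, so that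
  each automorphism of the ring is represented by exactly one HOL function.\<close>

definition ring_auto :: "('a, 'b) ring_scheme \<Rightarrow> ('a \<Rightarrow> 'a) set"
  where "ring_auto S = ring_iso S S \<inter> extensional (carrier S)"

definition RingAutoGroup :: "('a, 'b) ring_scheme \<Rightarrow> ('a \<Rightarrow> 'a) monoid"
  where "RingAutoGroup S = BijGroup (carrier S) \<lparr>carrier := ring_auto S\<rparr>"

lemma ring_auto_subset_Bij: "ring_auto S \<subseteq> Bij (carrier S)"
  by (auto simp: ring_auto_def ring_iso_def Bij_def)

lemma (in ring) subgroup_ring_auto: "subgroup (ring_auto R) (BijGroup (carrier R))"
proof (rule subgroup.intro)
  show "ring_auto R \<subseteq> carrier (BijGroup (carrier R))"
    using ring_auto_subset_Bij by (simp add: BijGroup_def)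
next
  fix f g assume fg: "f \<in> ring_auto R" "g \<in> ring_auto R"
  then have B: "f \<in> Bij (carrier R)" "g \<in> Bij (carrier R)"
    using ring_auto_subset_Bij by auto
  have "f \<circ> g \<in> ring_iso R R"
    using fg by (auto simp: ring_auto_def intro: ring_iso_set_trans)
  then have "compose (carrier R) f g \<in> ring_iso R R"
    by (rule ring_iso_restrict) (simp add: compose_eq)
  then show "f \<otimes>\<^bsub>BijGroup (carrier R)\<^esub> g \<in> ring_auto R"
    using B by (simp add: BijGroup_def ring_auto_def)
next
  show "\<one>\<^bsub>BijGroup (carrier R)\<^esub> \<in> ring_auto R"
    by (auto simp: BijGroup_def ring_auto_def intro: ring_iso_restrict[OF ring_iso_set_refl])
next
  fix f assume f: "f \<in> ring_auto R"
  then have B: "f \<in> Bij (carrier R)"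
    using ring_auto_subset_Bij by auto
  have "inv_into (carrier R) f \<in> ring_iso R R"
    using f ring_iso_set_sym[OF ring_axioms] by (auto simp: ring_auto_def)
  then have "restrict (inv_into (carrier R) f) (carrier R) \<in> ring_iso R R"
    by (rule ring_iso_restrict) simp
  then show "inv\<^bsub>BijGroup (carrier R)\<^esub> f \<in> ring_auto R"
    using B by (simp add: inv_BijGroup ring_auto_def)
qed

theorem (in ring) group_RingAutoGroup: "group (RingAutoGroup R)"
  unfolding RingAutoGroup_def
  by (rule subgroup.subgroup_is_group[OF subgroup_ring_auto group_BijGroup])

definition fixed_points :: "'a set \<Rightarrow> ('a \<Rightarrow> 'a) set \<Rightarrow> 'a set"
  where "fixed_points A G = {a \<in> A. \<forall>\<sigma>\<in>G. \<sigma> a = a}"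

definition fixed_ring :: "('a, 'b) ring_scheme \<Rightarrow> ('a \<Rightarrow> 'a) set \<Rightarrow> ('a, 'b) ring_scheme"
  where "fixed_ring S G = S \<lparr>carrier := fixed_points (carrier S) G\<rparr>"

text \<open>Root-closedness is only meaningful for an extension of commutative rings, so this is part of
  the definition; asserting it for two rings of invariants includes that they form an
  extension.\<close>

definition root_closed_in :: "'a set \<Rightarrow> ('a, 'b) ring_scheme \<Rightarrow> bool"
  where "root_closed_in R S \<longleftrightarrow> cring S \<and> subring R S \<and>
    (\<forall>x\<in>carrier S. \<forall>n::nat. n \<ge> 1 \<longrightarrow> x [^]\<^bsub>S\<^esub> n \<in> R \<longrightarrow> x \<in> R)"

end

theory Submission
  imports Defs
begin

text \<open>
  A fixed ring inherits its structure because automorphisms commute with the ring operations: the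
  elements of a subring fixed by a family of endomorphisms again form a subring. Applied to
  the carrier of \<open>S\<close> and to \<open>R\<close> this shows that the invariants of \<open>R\<close> and of \<open>S\<close> are nested
  subrings of \<open>S\<close>. Root-closedness is then immediate: if \<open>x \<in> S\<^sup>G\<close> and \<open>x\<^sup>n \<in> R\<^sup>G\<close>, then \<open>x \<in> R\<close>
  because \<open>R\<close> is root-closed in \<open>S\<close>, and \<open>x\<close> is fixed by \<open>G\<close> from the start, so
  \<open>x \<in> R \<inter> S\<^sup>G = R\<^sup>G\<close>.
\<close>

lemma (in ring) subring_fixed_points:
  assumes A: "subring A R" and G: "G \<subseteq> ring_hom R R"
  shows "subring (fixed_points A G) R"
proof (rule subringI)
  have A_carrier: "A \<subseteq> carrier R"
    by (rule subringE(1)[OF A])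
  then show "fixed_points A G \<subseteq> carrier R"
    by (auto simp: fixed_points_def)
  show "\<one> \<in> fixed_points A G"
    using G subringE(3)[OF A] by (auto simp: fixed_points_def dest: ring_hom_one)
  fix h assume h: "h \<in> fixed_points A G"
  then have h_carrier: "h \<in> carrier R"
    using A_carrier by (auto simp: fixed_points_def)
  have "\<sigma> (\<ominus> h) = \<ominus> h" if "\<sigma> \<in> G" for \<sigma>
  proof -
    interpret ring_hom_ring R R \<sigma>
      using that G by (intro ring_hom_ringI2 ring_axioms) auto
    have "\<sigma> h = h"
      using h that by (simp add: fixed_points_def)
    then show ?thesis
      using h_carrier by simp
  qed
  then show "\<ominus> h \<in> fixed_points A G"
    using h subringE(5)[OF A] by (auto simp: fixed_points_def)
  fix k assume k: "k \<in> fixed_points A G"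
  then have k_carrier: "k \<in> carrier R"
    using A_carrier by (auto simp: fixed_points_def)
  have "\<sigma> (h \<otimes> k) = h \<otimes> k \<and> \<sigma> (h \<oplus> k) = h \<oplus> k" if "\<sigma> \<in> G" for \<sigma>
  proof -
    interpret ring_hom_ring R R \<sigma>
      using that G by (intro ring_hom_ringI2 ring_axioms) auto
    have "\<sigma> h = h" "\<sigma> k = k"
      using h k that by (simp_all add: fixed_points_def)
    then show ?thesis
      using h_carrier k_carrier by simp
  qed
  then show "h \<otimes> k \<in> fixed_points A G" "h \<oplus> k \<in> fixed_points A G"
    using h k subringE(6,7)[OF A] by (auto simp: fixed_points_def)
qed

theorem proposition2p9p2:
  fixes S :: "('a, 'b) ring_scheme" and R :: "'a set" and G :: "('a \<Rightarrow> 'a) set"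
  assumes "cring S"
    and "subring R S"
    and "subgroup G (RingAutoGroup S)"
    and "\<And>\<sigma>. \<sigma> \<in> G \<Longrightarrow> \<sigma> ` R \<subseteq> R"
    and "root_closed_in R S"
  shows "root_closed_in (fixed_points R G) (fixed_ring S G)"
proof -
  interpret S: cring S by fact
  have G: "G \<subseteq> ring_hom S S"
    using subgroup.subset[OF assms(3)]
    by (auto simp: RingAutoGroup_def ring_auto_def ring_iso_def)
  have SG: "subring (fixed_points (carrier S) G) S"
    by (rule S.subring_fixed_points[OF S.carrier_is_subring G])
  have RG: "subring (fixed_points R G) S"
    by (rule S.subring_fixed_points[OF assms(2) G])
  have "subcring (fixed_points (carrier S) G) S"
    using SG by (rule S.subcringI')
  then have cring_SG: "cring (fixed_ring S G)"
    using S.subcring_iff[OF subringE(1)[OF SG]] by (simp add: fixed_ring_def)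
  have "subring (fixed_points R G) (fixed_ring S G)"
  proof (rule ring.ring_incl_imp_subring)
    show "ring (fixed_ring S G)"
      using cring_SG by (rule cring.axioms(1))
    show "fixed_points R G \<subseteq> carrier (fixed_ring S G)"
      using subringE(1)[OF assms(2)] by (auto simp: fixed_points_def fixed_ring_def)
    show "ring (fixed_ring S G\<lparr>carrier := fixed_points R G\<rparr>)"
      using S.subring_is_ring[OF RG] by (simp add: fixed_ring_def)
  qed
  moreover have "x \<in> fixed_points R G"
    if x: "x \<in> carrier (fixed_ring S G)" and "n \<ge> 1"
      and "x [^]\<^bsub>fixed_ring S G\<^esub> n \<in> fixed_points R G" for x and n :: nat
  proof -
    have "x [^]\<^bsub>S\<^esub> n \<in> R"
      using that(3) by (simp add: fixed_ring_def fixed_points_def flip: S.nat_pow_consistent)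
    then have "x \<in> R"
      using x \<open>n \<ge> 1\<close> assms(5)
      by (auto simp: root_closed_in_def fixed_ring_def fixed_points_def)
    then show ?thesis
      using x by (simp add: fixed_ring_def fixed_points_def)
  qed
  ultimately show ?thesis
    using cring_SG unfolding root_closed_in_def by blast
qed

end
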